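(* Consider an AR(1) system with gain $a\in\mathbb{R}$, $a\neq 2$, and noise bounded by $B>0$, which Alice stabilizes using the one-bit controller $(U_n)$. Willie observes the control signal through an additive white Gaussian noise channel for $K$ consecutive samples: he observes $W_n$, $n=k,\dots,k+K-1$, where $$\mathcal{H}_0:\ W_n=v_n,\qquad \mathcal{H}_1:\ W_n=U_n+v_n,$$ and $v_n\sim\mathcal{N}(0,\sigma_v^2)$ are i.i.d. and independent of the system, with variance $\sigma_v^2>0$ known to Willie. Let $E_U=\left(\frac{aB}{2-a}\right)^2$ be the average energy of the one-bit controller and $\mathrm{SNR}=E_U/\sigma_v^2$. Then for any $\delta>0$, Willie can achieve $1-\delta$-detection as long as the observation window satisfies $K>K_0(\delta)$, where $$K_0(\delta)=\frac{4}{\delta\cdot \mathrm{SNR}^2}\left(1+\sqrt{1+2\cdot\mathrm{SNR}}\right)^2.$$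
   Context: The AR(1) system is $X_n=aX_{n-1}+Z_n-U_n$, $n\ge1$, $X_0=0$, where $(Z_n)$ are i.i.d. with $|Z_n|\le B$ for all $n$. The one-bit controller is $U_n=\frac{a}{2}C_{n-1}\operatorname{sgn}(X_{n-1})$ for $n>1$, with $U_1=0$, where $C_n=\frac a2 C_{n-1}+B$ and $C_1=\frac{B}{1-a/2}$ (so $C_n=\frac{B}{1-a/2}$ for all $n$); here $\operatorname{sgn}$ takes values in $\{-1,+1\}$, so $U_n^2=E_U=\left(\frac{aB}{2-a}\right)^2$ for every $n>1$. The observation window starts at some $k\ge2$, when the controller is active. For a test of $\mathcal{H}_0$ against $\mathcal{H}_1$, $\alpha$ is the false alarm probability (deciding $\mathcal{H}_1$ when $\mathcal{H}_0$ is true) and $\beta$ the miss detection probability (deciding $\mathcal{H}_0$ when $\mathcal{H}_1$ is true). Willie achieves $1-\delta$-detection if he has a test with $\alpha+\beta\le\delta$. The bound on $K$ is understood for $E_U>0$ (for $E_U=0$, $K_0(\delta)=+\infty$). *)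

theory Defs
  imports "HOL-Probability.Probability"
begin

text \<open>
  Unlike \<open>sgn\<close>, the controller's sign takes values in \<open>{-1, 1}\<close> also at \<open>0\<close>. Either value at
  \<open>0\<close> is allowed.
\<close>

definition binary_sign :: "(real \<Rightarrow> real) \<Rightarrow> bool" where
  "binary_sign s \<longleftrightarrow> (\<forall>x>0. s x = 1) \<and> (\<forall>x<0. s x = -1) \<and> s 0 \<in> {-1, 1}"

text \<open>The index starts at \<open>1\<close>; the value at \<open>0\<close> is a dummy that is never used.\<close>

fun one_bit_C :: "real \<Rightarrow> real \<Rightarrow> nat \<Rightarrow> real" where
  "one_bit_C a B 0 = 0"
| "one_bit_C a B (Suc 0) = B / (1 - a / 2)"
| "one_bit_C a B (Suc (Suc n)) = a / 2 * one_bit_C a B (Suc n) + B"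

text \<open>
  State and control along one path \<open>z\<close> of the system noise. The control starts at time \<open>1\<close>;
  its value at time \<open>0\<close> and \<open>z 0\<close> play no role.
\<close>

function ar1_state :: "(real \<Rightarrow> real) \<Rightarrow> real \<Rightarrow> real \<Rightarrow> (nat \<Rightarrow> real) \<Rightarrow> nat \<Rightarrow> real"
  and one_bit_control :: "(real \<Rightarrow> real) \<Rightarrow> real \<Rightarrow> real \<Rightarrow> (nat \<Rightarrow> real) \<Rightarrow> nat \<Rightarrow> real" where
  "ar1_state s a B z 0 = 0"
| "ar1_state s a B z (Suc n) =
     a * ar1_state s a B z n + z (Suc n) - one_bit_control s a B z (Suc n)"
| "one_bit_control s a B z 0 = 0"
| "one_bit_control s a B z (Suc 0) = 0"
| "one_bit_control s a B z (Suc (Suc n)) =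
     a / 2 * one_bit_C a B (Suc n) * s (ar1_state s a B z (Suc n))"
  by pat_completeness auto
termination
  by (relation "Wellfounded.measure (\<lambda>x. case x of
        Inl (s, a, B, z, n) \<Rightarrow> 2 * n | Inr (s, a, B, z, n) \<Rightarrow> 2 * n - 1)") auto

definition control_energy :: "real \<Rightarrow> real \<Rightarrow> real" where
  "control_energy a B = (a * B / (2 - a))\<^sup>2"

definition control_snr :: "real \<Rightarrow> real \<Rightarrow> real \<Rightarrow> real" where
  "control_snr a B \<sigma> = control_energy a B / \<sigma>\<^sup>2"

definition K0 :: "real \<Rightarrow> real \<Rightarrow> ereal" where
  "K0 snr \<delta> =
     (if snr = 0 then \<infinity> else ereal (4 / (\<delta> * snr\<^sup>2) * (1 + sqrt (1 + 2 * snr))\<^sup>2))"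

text \<open>
  A test is a measurable predicate \<open>\<phi>\<close> on the observation space \<open>N\<close>, with \<open>\<phi> w\<close> meaning that
  the alternative hypothesis is decided on observing \<open>w\<close>. \<open>W\<^sub>0\<close> and \<open>W\<^sub>1\<close> are the observations
  under the null and the alternative hypothesis.
\<close>

definition false_alarm :: "'a measure \<Rightarrow> ('a \<Rightarrow> 'b) \<Rightarrow> ('b \<Rightarrow> bool) \<Rightarrow> real" where
  "false_alarm M W\<^sub>0 \<phi> = measure M {\<omega> \<in> space M. \<phi> (W\<^sub>0 \<omega>)}"

definition miss_detection :: "'a measure \<Rightarrow> ('a \<Rightarrow> 'b) \<Rightarrow> ('b \<Rightarrow> bool) \<Rightarrow> real" where
  "miss_detection M W\<^sub>1 \<phi> = measure M {\<omega> \<in> space M. \<not> \<phi> (W\<^sub>1 \<omega>)}"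

text \<open>The parameter \<open>\<delta>\<close> bounds the total error: this is \<open>(1 - \<delta>)\<close>-detection.\<close>

definition achieves_detection ::
  "'a measure \<Rightarrow> 'b measure \<Rightarrow> ('a \<Rightarrow> 'b) \<Rightarrow> ('a \<Rightarrow> 'b) \<Rightarrow> real \<Rightarrow> bool" where
  "achieves_detection M N W\<^sub>0 W\<^sub>1 \<delta> \<longleftrightarrow>
     (\<exists>\<phi> \<in> measurable N (count_space UNIV).
        false_alarm M W\<^sub>0 \<phi> + miss_detection M W\<^sub>1 \<phi> \<le> \<delta>)"

end

theory Submission imports Defs begin

text \<open>
  Willie uses an energy detector: he decides that Alice is active when \<open>\<Sum> W\<^sub>n\<^sup>2\<close> is large. Each
  \<open>W\<^sub>n\<^sup>2\<close> has mean \<open>\<sigma>\<^sup>2\<close> without control and mean \<open>E + \<sigma>\<^sup>2\<close> with control, where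
  \<open>E = (a B / (2 - a))\<^sup>2\<close>, so the two sums have means \<open>K E\<close> apart, whereas their standard
  deviations grow only like \<open>sqrt K\<close>. Chebyshev's inequality, applied on each side of a suitable
  threshold between the means, turns this into the claimed window length.

  The controls are dependent random variables, but only their signs are random: after time \<open>1\<close> the
  square of every control is \<open>E\<close> (\<open>one_bit_control_energy\<close>). For a fixed signal \<open>u\<close> with
  \<open>u\<^sub>n\<^sup>2 = E\<close>, the energies \<open>(u\<^sub>n + v\<^sub>n)\<^sup>2\<close> are independent, with variance
  \<open>4 E \<sigma>\<^sup>2 + 2 \<sigma>\<^sup>4\<close> whatever the signs are; hence \<open>noisy_energy_deviation\<close> bounds the deviation
  of the total energy uniformly in \<open>u\<close>. As the system noise is independent of the channel noise,
  the uniform bound survives averaging over the random control (\<open>prob_le_by_conditioning\<close>).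
  The signal \<open>u = 0\<close> gives the null hypothesis.

  In units of \<open>\<sigma>\<^sup>2\<close> per sample, with \<open>r = E / \<sigma>\<^sup>2\<close>, a threshold \<open>1 + \<tau>\<close> between the means \<open>1\<close>
  and \<open>1 + r\<close> has \<open>\<alpha> \<le> 2 / (K \<tau>\<^sup>2)\<close> and \<open>\<beta> \<le> 2 (1 + 2 r) / (K (r - \<tau>)\<^sup>2)\<close>. Both are at most
  \<open>\<delta> / 2\<close> when \<open>\<tau> = 2 / sqrt (K \<delta>)\<close> and \<open>r - \<tau> \<ge> \<tau> sqrt (1 + 2 r)\<close>, and the latter,
  solved for \<open>K\<close>, is \<open>K \<ge> K\<^sub>0(\<delta>)\<close>.
\<close>

section \<open>Deviation of the energy of a fixed signal in Gaussian noise\<close>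

text \<open>The mixed terms vanish because independent centered variables are uncorrelated.\<close>

lemma (in prob_space) second_moment_sum_indep_centered:
  fixes Y :: "'i \<Rightarrow> 'a \<Rightarrow> real"
  assumes "finite I" and indep: "indep_vars (\<lambda>_. borel) Y I"
    and square: "\<And>i. i \<in> I \<Longrightarrow> integrable M (\<lambda>\<omega>. (Y i \<omega>)\<^sup>2)"
    and centered: "\<And>i. i \<in> I \<Longrightarrow> expectation (Y i) = 0"
  shows "integrable M (\<lambda>\<omega>. (\<Sum>i\<in>I. Y i \<omega>)\<^sup>2)"
    and "expectation (\<lambda>\<omega>. (\<Sum>i\<in>I. Y i \<omega>)\<^sup>2) = (\<Sum>i\<in>I. expectation (\<lambda>\<omega>. (Y i \<omega>)\<^sup>2))"
proof -
  have rv: "random_variable borel (Y i)" if "i \<in> I" for i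
    using indep that unfolding indep_vars_def2 by simp
  have int: "integrable M (Y i)" if "i \<in> I" for i
    using square_integrable_imp_integrable[OF rv square] that by blast
  have cross: "integrable M (\<lambda>\<omega>. Y i \<omega> * Y j \<omega>)
      \<and> expectation (\<lambda>\<omega>. Y i \<omega> * Y j \<omega>) = (if i = j then expectation (\<lambda>\<omega>. (Y i \<omega>)\<^sup>2) else 0)"
    if "i \<in> I" "j \<in> I" for i j
  proof (cases "i = j")
    case True
    then show ?thesis using square that by (simp add: power2_eq_square)
  next
    case False
    have "indep_vars (\<lambda>_. borel) Y {i, j}"
      using indep_vars_subset[OF indep] that by simp
    then show ?thesis
      using False centered that
        indep_vars_lebesgue_integral[of "{i, j}" Y] indep_vars_integrable[of "{i, j}" Y] int
      by auto
  qed
  have expand: "(\<Sum>i\<in>I. Y i \<omega>)\<^sup>2 = (\<Sum>i\<in>I. \<Sum>j\<in>I. Y i \<omega> * Y j \<omega>)" for \<omega>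
    by (simp add: power2_eq_square sum_product)
  show "integrable M (\<lambda>\<omega>. (\<Sum>i\<in>I. Y i \<omega>)\<^sup>2)"
    unfolding expand using cross by (intro Bochner_Integration.integrable_sum) blast
  have "expectation (\<lambda>\<omega>. (\<Sum>i\<in>I. Y i \<omega>)\<^sup>2) = (\<Sum>i\<in>I. \<Sum>j\<in>I. expectation (\<lambda>\<omega>. Y i \<omega> * Y j \<omega>))"
    unfolding expand using cross by (simp add: Bochner_Integration.integral_sum)
  also have "\<dots> = (\<Sum>i\<in>I. \<Sum>j\<in>I. if i = j then expectation (\<lambda>\<omega>. (Y i \<omega>)\<^sup>2) else 0)"
    using cross by (intro sum.cong) auto
  also have "\<dots> = (\<Sum>i\<in>I. expectation (\<lambda>\<omega>. (Y i \<omega>)\<^sup>2))"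
    using \<open>finite I\<close> by (simp add: sum.delta)
  finally show "expectation (\<lambda>\<omega>. (\<Sum>i\<in>I. Y i \<omega>)\<^sup>2) = (\<Sum>i\<in>I. expectation (\<lambda>\<omega>. (Y i \<omega>)\<^sup>2))" .
qed

text \<open>
  The deviation of the energy from its mean is \<open>2 u V + (V\<^sup>2 - \<sigma>\<^sup>2)\<close>. The two terms are
  uncorrelated because odd Gaussian moments vanish, so the second moment depends on \<open>u\<close> only
  through \<open>u\<^sup>2\<close>: this is what makes the random sign of the control harmless.
\<close>

lemma (in prob_space) noisy_energy_moments:
  fixes u \<sigma> :: real
  assumes V: "distributed M lborel V (normal_density 0 \<sigma>)" and "\<sigma> > 0"
  defines "D \<equiv> \<lambda>\<omega>. (u + V \<omega>)\<^sup>2 - (u\<^sup>2 + \<sigma>\<^sup>2)"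
  shows "expectation D = 0" and "integrable M (\<lambda>\<omega>. (D \<omega>)\<^sup>2)"
    and "expectation (\<lambda>\<omega>. (D \<omega>)\<^sup>2) = 4 * u\<^sup>2 * \<sigma>\<^sup>2 + 2 * \<sigma> ^ 4"
proof -
  have int: "integrable M (\<lambda>\<omega>. V \<omega> ^ n)" for n
    using distributed_integrable[OF V, of "\<lambda>x. x ^ n"] integrable_normal_moment[OF \<open>\<sigma> > 0\<close>, of 0 n]
    by simp
  have moment: "expectation (\<lambda>\<omega>. V \<omega> ^ n) = (\<integral>x. normal_density 0 \<sigma> x * x ^ n \<partial>lborel)" for n
    using distributed_integral[OF V, of "\<lambda>x. x ^ n"] by simp
  have m1: "expectation V = 0" and m2: "expectation (\<lambda>\<omega>. (V \<omega>)\<^sup>2) = \<sigma>\<^sup>2"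
    and m3: "expectation (\<lambda>\<omega>. V \<omega> ^ 3) = 0" and m4: "expectation (\<lambda>\<omega>. V \<omega> ^ 4) = 3 * \<sigma> ^ 4"
    using moment[of 1] moment[of 2] moment[of 3] moment[of 4] \<open>\<sigma> > 0\<close>
      integral_normal_moment_odd[OF \<open>\<sigma> > 0\<close>, of 0 0] integral_normal_moment_odd[OF \<open>\<sigma> > 0\<close>, of 0 1]
      integral_normal_moment_even[OF \<open>\<sigma> > 0\<close>, of 0 1] integral_normal_moment_even[OF \<open>\<sigma> > 0\<close>, of 0 2]
    by (simp_all add: fact_numeral power_divide flip: power_mult)
  have int1: "integrable M V" using int[of 1] by simp
  have D: "D \<omega> = 2 * u * V \<omega> + (V \<omega>)\<^sup>2 - \<sigma>\<^sup>2" for \<omega>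
    by (simp add: D_def power2_sum)
  have D2: "(D \<omega>)\<^sup>2 = V \<omega> ^ 4 + 4 * u * V \<omega> ^ 3 + (4 * u\<^sup>2 - 2 * \<sigma>\<^sup>2) * (V \<omega>)\<^sup>2
      - 4 * u * \<sigma>\<^sup>2 * V \<omega> + \<sigma> ^ 4" for \<omega>
    unfolding D by algebra
  show "expectation D = 0"
    unfolding D using int[of 2] int1 by (simp add: m1 m2 prob_space)
  show "integrable M (\<lambda>\<omega>. (D \<omega>)\<^sup>2)"
    unfolding D2 using int int1 by simp
  show "expectation (\<lambda>\<omega>. (D \<omega>)\<^sup>2) = 4 * u\<^sup>2 * \<sigma>\<^sup>2 + 2 * \<sigma> ^ 4"
    unfolding D2 using int int1
    by (simp add: m1 m2 m3 m4 prob_space algebra_simps flip: power_add)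
qed

text \<open>
  This is Chebyshev's inequality. Only the squares of the signal are prescribed, so that one bound
  serves all sign patterns of the control, and \<open>e = 0\<close> covers pure noise.
\<close>

lemma (in prob_space) noisy_energy_deviation:
  fixes V :: "'i \<Rightarrow> 'a \<Rightarrow> real" and u :: "'i \<Rightarrow> real" and e \<sigma> c :: real
  assumes "finite I" and indep: "indep_vars (\<lambda>_. borel) V I"
    and normal: "\<And>i. i \<in> I \<Longrightarrow> distributed M lborel (V i) (normal_density 0 \<sigma>)"
    and "\<sigma> > 0" and energy: "\<And>i. i \<in> I \<Longrightarrow> (u i)\<^sup>2 = e" and "c > 0"
  shows "prob {\<omega> \<in> space M. c \<le> \<bar>(\<Sum>i\<in>I. (u i + V i \<omega>)\<^sup>2) - card I * (e + \<sigma>\<^sup>2)\<bar>}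
    \<le> card I * (4 * e * \<sigma>\<^sup>2 + 2 * \<sigma> ^ 4) / c\<^sup>2"
proof -
  define D where "D i \<omega> = (u i + V i \<omega>)\<^sup>2 - ((u i)\<^sup>2 + \<sigma>\<^sup>2)" for i \<omega>
  have moments: "expectation (D i) = 0" "integrable M (\<lambda>\<omega>. (D i \<omega>)\<^sup>2)"
    "expectation (\<lambda>\<omega>. (D i \<omega>)\<^sup>2) = 4 * e * \<sigma>\<^sup>2 + 2 * \<sigma> ^ 4" if "i \<in> I" for i
    using noisy_energy_moments[OF normal[OF that] \<open>\<sigma> > 0\<close>, of "u i"]
    by (simp_all add: D_def[abs_def] energy that)
  have indep_D: "indep_vars (\<lambda>_. borel) D I"
    unfolding D_def by (rule indep_vars_compose2[OF indep]) simp
  note second = second_moment_sum_indep_centered[OF \<open>finite I\<close> indep_D moments(2) moments(1)]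
  have rv: "random_variable borel (D i)" if "i \<in> I" for i
    using indep_D that unfolding indep_vars_def2 by simp
  have sum_D: "(\<Sum>i\<in>I. D i \<omega>) = (\<Sum>i\<in>I. (u i + V i \<omega>)\<^sup>2) - card I * (e + \<sigma>\<^sup>2)" for \<omega>
    by (simp add: D_def sum_subtractf energy)
  have "prob {\<omega> \<in> space M. c \<le> \<bar>\<Sum>i\<in>I. D i \<omega>\<bar>} \<le> expectation (\<lambda>\<omega>. (\<Sum>i\<in>I. D i \<omega>)\<^sup>2) / c\<^sup>2"
    using rv second(1) \<open>c > 0\<close> by (intro second_moment_method) auto
  also have "expectation (\<lambda>\<omega>. (\<Sum>i\<in>I. D i \<omega>)\<^sup>2) = card I * (4 * e * \<sigma>\<^sup>2 + 2 * \<sigma> ^ 4)"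
    using second(2) by (simp add: moments(3))
  finally show ?thesis by (simp add: sum_D)
qed

section \<open>Averaging over an independent signal\<close>

text \<open>
  By independence the joint law of \<open>X\<close> and \<open>Y\<close> is a product measure, so the probability is the
  average over \<open>x\<close> of the probabilities with \<open>X\<close> frozen at \<open>x\<close>.
\<close>

lemma (in prob_space) prob_le_by_conditioning:
  assumes indep: "indep_var S X T Y"
    and [measurable]: "{p \<in> space (S \<Otimes>\<^sub>M T). P (fst p) (snd p)} \<in> sets (S \<Otimes>\<^sub>M T)"
    and bound: "\<And>x. x \<in> space S \<Longrightarrow> prob {\<omega> \<in> space M. P x (Y \<omega>)} \<le> b" and "b \<ge> 0"
  shows "prob {\<omega> \<in> space M. P (X \<omega>) (Y \<omega>)} \<le> b"
proof -
  let ?A = "{p \<in> space (S \<Otimes>\<^sub>M T). P (fst p) (snd p)}"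
  have [measurable]: "X \<in> measurable M S" "Y \<in> measurable M T"
    and joint: "distr M (S \<Otimes>\<^sub>M T) (\<lambda>\<omega>. (X \<omega>, Y \<omega>)) = distr M S X \<Otimes>\<^sub>M distr M T Y"
    using indep by (auto simp: indep_var_distribution_eq)
  interpret X: prob_space "distr M S X" by (rule prob_space_distr) simp
  interpret Y: prob_space "distr M T Y" by (rule prob_space_distr) simp
  have slice: "emeasure (distr M T Y) (Pair x -` ?A) \<le> ennreal b" if "x \<in> space S" for x
  proof -
    have "emeasure (distr M T Y) (Pair x -` ?A) = emeasure M (Y -` (Pair x -` ?A) \<inter> space M)"
      by (intro emeasure_distr sets_Pair1[where ?M1.0 = S]) simp_all
    also have "Y -` (Pair x -` ?A) \<inter> space M = {\<omega> \<in> space M. P x (Y \<omega>)}"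
      using that measurable_space[of Y M T] by (auto simp: space_pair_measure)
    finally show ?thesis using bound[OF that] by (simp add: emeasure_eq_measure ennreal_leI)
  qed
  have "emeasure M {\<omega> \<in> space M. P (X \<omega>) (Y \<omega>)} =
      emeasure M ((\<lambda>\<omega>. (X \<omega>, Y \<omega>)) -` ?A \<inter> space M)"
    using measurable_space[of X M S] measurable_space[of Y M T]
    by (intro arg_cong[where f = "emeasure M"]) (auto simp: space_pair_measure)
  also have "\<dots> = emeasure (distr M S X \<Otimes>\<^sub>M distr M T Y) ?A"
    by (simp add: emeasure_distr assms(2) flip: joint)
  also have "\<dots> = (\<integral>\<^sup>+x. emeasure (distr M T Y) (Pair x -` ?A) \<partial>distr M S X)"
    by (rule Y.emeasure_pair_measure_alt) simp
  also have "\<dots> \<le> (\<integral>\<^sup>+x. ennreal b \<partial>distr M S X)"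
    using slice by (intro nn_integral_mono) simp
  also have "\<dots> = ennreal b" using X.emeasure_space_1 by simp
  finally show ?thesis using \<open>b \<ge> 0\<close> by (simp add: emeasure_eq_measure)
qed

section \<open>The one-bit controller\<close>

text \<open>The initial value is the fixed point of the recursion \<open>C = a / 2 * C + B\<close>.\<close>

lemma one_bit_C_stationary: "a \<noteq> 2 \<Longrightarrow> one_bit_C a B (Suc n) = B / (1 - a / 2)"
  by (induction n) (simp_all add: field_simps)

lemma one_bit_control_energy:
  assumes "binary_sign s" "a \<noteq> 2" "n \<ge> 2"
  shows "(one_bit_control s a B z n)\<^sup>2 = control_energy a B"
proof -
  obtain m where n: "n = Suc (Suc m)" using \<open>n \<ge> 2\<close> by (metis add_2_eq_Suc le_Suc_ex)
  have "s x = 1 \<or> s x = - 1" for x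
    using \<open>binary_sign s\<close> unfolding binary_sign_def
    by (cases x "0 :: real" rule: linorder_cases) auto
  then have "(s x)\<^sup>2 = 1" for x by (metis one_power2 power2_minus)
  moreover have "a / 2 * (B / (1 - a / 2)) = a * B / (2 - a)"
    using \<open>a \<noteq> 2\<close> by (simp add: field_simps)
  ultimately show ?thesis
    using \<open>a \<noteq> 2\<close>
    by (simp only: n one_bit_control.simps one_bit_C_stationary power_mult_distrib [of _ "s _"]
        control_energy_def mult_1_right not_False_eq_True)
qed

lemma binary_sign_measurable: "binary_sign s \<Longrightarrow> s \<in> borel_measurable borel"
proof -
  assume "binary_sign s"
  then have "s = (\<lambda>x. if x > 0 then 1 else if x < 0 then - 1 else s 0)"
    unfolding binary_sign_def fun_eq_iff by (metis linorder_neqE)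
  moreover have "(\<lambda>x::real. if x > 0 then 1 else if x < 0 then - 1 else s 0) \<in> borel_measurable borel"
    by measurable
  ultimately show ?thesis by simp
qed

text \<open>
  State and control depend on the system noise from time \<open>1\<close> on only, so that replacing the noise
  by its restriction to these times, the variable in the independence hypothesis, changes nothing.
\<close>

lemma one_bit_control_cong:
  assumes "\<And>i. i \<ge> 1 \<Longrightarrow> z i = z' i"
  shows "one_bit_control s a B z n = one_bit_control s a B z' n"
proof -
  have "ar1_state s a B z n = ar1_state s a B z' n
      \<and> one_bit_control s a B z (Suc n) = one_bit_control s a B z' (Suc n)" for n
    using assms by (induction n) simp_all
  then show ?thesis by (cases n) simp_all
qed

lemma one_bit_control_measurable:
  assumes "binary_sign s"
  shows "(\<lambda>z. one_bit_control s a B z n) \<in> borel_measurable (PiM {1..} (\<lambda>_. borel))"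
proof -
  note [measurable] = binary_sign_measurable[OF assms]
  have "(\<lambda>z. ar1_state s a B z n) \<in> borel_measurable (PiM {1..} (\<lambda>_. borel))
      \<and> (\<lambda>z. one_bit_control s a B z (Suc n)) \<in> borel_measurable (PiM {1..} (\<lambda>_. borel))" for n
  proof (induction n)
    case 0
    show ?case by simp
  next
    case (Suc n)
    then have [measurable]: "(\<lambda>z. ar1_state s a B z n) \<in> borel_measurable (PiM {1..} (\<lambda>_. borel))"
      "(\<lambda>z. one_bit_control s a B z (Suc n)) \<in> borel_measurable (PiM {1..} (\<lambda>_. borel))"
      by auto
    have [measurable]: "(\<lambda>z. ar1_state s a B z (Suc n)) \<in> borel_measurable (PiM {1..} (\<lambda>_. borel))"
      unfolding ar1_state.simps by measurable
    show ?case
      unfolding one_bit_control.simps by (intro conjI) measurable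
  qed
  then show ?thesis by (cases n) auto
qed

section \<open>The energy detector\<close>

theorem theorem3:
  fixes M :: "'a measure" and Z v U :: "nat \<Rightarrow> 'a \<Rightarrow> real" and s :: "real \<Rightarrow> real"
    and a B \<sigma> \<delta> :: real and k K :: nat
  assumes "prob_space M"
    and "a \<noteq> 2" and "B > 0" and "\<sigma> > 0" and "\<delta> > 0" and "k \<ge> 2"
    and "binary_sign s"
    and Z_indep: "prob_space.indep_vars M (\<lambda>_. borel) Z {1..}"
    and Z_ident: "\<And>n. n \<ge> 1 \<Longrightarrow> distr M borel (Z n) = distr M borel (Z 1)"
    and Z_bounded: "\<And>n. n \<ge> 1 \<Longrightarrow> AE \<omega> in M. \<bar>Z n \<omega>\<bar> \<le> B"
    and U: "\<And>n \<omega>. U n \<omega> = one_bit_control s a B (\<lambda>i. Z i \<omega>) n"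
    and v_indep: "prob_space.indep_vars M (\<lambda>_. borel) v {k..<k + K}"
    and v_normal: "\<And>n. n \<in> {k..<k + K} \<Longrightarrow> distributed M lborel (v n) (normal_density 0 \<sigma>)"
    and Z_v_indep: "prob_space.indep_var M
      (PiM {1..} (\<lambda>_. borel)) (\<lambda>\<omega>. \<lambda>n\<in>{1..}. Z n \<omega>)
      (PiM {k..<k + K} (\<lambda>_. borel)) (\<lambda>\<omega>. \<lambda>n\<in>{k..<k + K}. v n \<omega>)"
    and window: "ereal (real K) > K0 (control_snr a B \<sigma>) \<delta>"
  shows "achieves_detection M (PiM {k..<k + K} (\<lambda>_. borel))
    (\<lambda>\<omega>. \<lambda>n\<in>{k..<k + K}. v n \<omega>)
    (\<lambda>\<omega>. \<lambda>n\<in>{k..<k + K}. U n \<omega> + v n \<omega>) \<delta>"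
proof -
  interpret prob_space M by fact
  define I where "I = {k..<k + K}"
  define e where "e = control_energy a B"
  define r where "r = control_snr a B \<sigma>"
  \<comment> \<open>The choice of \<open>\<tau>\<close> makes the Chebyshev bound \<open>2 / (K \<tau>\<^sup>2)\<close> on the false alarm equal to \<open>\<delta> / 2\<close>.\<close>
  define \<tau> where "\<tau> = 2 / sqrt (K * \<delta>)"
  define \<theta> where "\<theta> = K * \<sigma>\<^sup>2 * (1 + \<tau>)"
  define \<phi> where "\<phi> w \<longleftrightarrow> \<theta> \<le> (\<Sum>n\<in>I. (w n)\<^sup>2)" for w :: "nat \<Rightarrow> real"
  have r_eq: "e = r * \<sigma>\<^sup>2" and "r \<ge> 0"
    using \<open>\<sigma> > 0\<close> by (simp_all add: r_def e_def control_snr_def control_energy_def)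
  \<comment> \<open>Zero control energy is excluded because it would require an infinite window.\<close>
  have "r \<noteq> 0" using window by (auto simp: K0_def r_def)
  with \<open>r \<ge> 0\<close> have "r > 0" by simp
  have window_r: "4 / (\<delta> * r\<^sup>2) * (1 + sqrt (1 + 2 * r))\<^sup>2 < K"
    using window \<open>r \<noteq> 0\<close> by (simp add: K0_def r_def)
  have "0 \<le> 4 / (\<delta> * r\<^sup>2) * (1 + sqrt (1 + 2 * r))\<^sup>2"
    using \<open>\<delta> > 0\<close> by simp
  with window_r have "K > 0" by simp
  have "\<tau> > 0" using \<open>K > 0\<close> \<open>\<delta> > 0\<close> by (simp add: \<tau>_def)
  have tau_sq: "K * \<tau>\<^sup>2 * \<delta> = 4"
    using \<open>K > 0\<close> \<open>\<delta> > 0\<close> by (simp add: \<tau>_def power_divide)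
  \<comment> \<open>This is the window condition. Since \<open>sqrt (1 + 2 r)\<close> is the ratio of the standard deviations
      under the two hypotheses, the threshold is, in standard deviations, at least as far from the
      mean with control as from the mean without.\<close>
  have gap: "\<tau> * sqrt (1 + 2 * r) \<le> r - \<tau>"
  proof -
    have "(\<tau> * (1 + sqrt (1 + 2 * r)))\<^sup>2 = 4 / (K * \<delta>) * (1 + sqrt (1 + 2 * r))\<^sup>2"
      using tau_sq \<open>K > 0\<close> \<open>\<delta> > 0\<close> unfolding power_mult_distrib
      by (intro arg_cong[where f = "\<lambda>x. x * _"]) (simp add: field_simps)
    also have "\<dots> \<le> r\<^sup>2"
      using window_r \<open>K > 0\<close> \<open>\<delta> > 0\<close> \<open>r > 0\<close> by (simp add: field_simps)
    finally have "\<tau> * (1 + sqrt (1 + 2 * r)) \<le> r"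
      using \<open>r > 0\<close> by (meson less_imp_le power2_le_imp_le)
    then show ?thesis by (simp add: algebra_simps)
  qed

  have normal: "distributed M lborel (v n) (normal_density 0 \<sigma>)" if "n \<in> I" for n
    using v_normal that by (simp add: I_def)
  have indep: "indep_vars (\<lambda>_. borel) v I" using v_indep by (simp add: I_def)
  have rv: "random_variable borel (v n)" if "n \<in> I" for n
    using indep that unfolding indep_vars_def2 by simp
  have "finite I" "card I = K" by (simp_all add: I_def)
  note deviation = noisy_energy_deviation[OF \<open>finite I\<close> indep normal \<open>\<sigma> > 0\<close>, unfolded \<open>card I = K\<close>]

  have "false_alarm M (\<lambda>\<omega>. \<lambda>n\<in>I. v n \<omega>) \<phi> = prob {\<omega> \<in> space M. \<theta> \<le> (\<Sum>n\<in>I. (v n \<omega>)\<^sup>2)}"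
    by (simp add: false_alarm_def \<phi>_def)
  also have "\<dots> \<le> prob {\<omega> \<in> space M. K * \<sigma>\<^sup>2 * \<tau> \<le> \<bar>(\<Sum>n\<in>I. (0 + v n \<omega>)\<^sup>2) - K * (0 + \<sigma>\<^sup>2)\<bar>}"
    using rv by (intro finite_measure_mono) (auto simp: \<theta>_def algebra_simps)
  also have "\<dots> \<le> K * (4 * 0 * \<sigma>\<^sup>2 + 2 * \<sigma> ^ 4) / (K * \<sigma>\<^sup>2 * \<tau>)\<^sup>2"
    using \<open>K > 0\<close> \<open>\<sigma> > 0\<close> \<open>\<tau> > 0\<close> by (intro deviation) simp_all
  also have "\<dots> = 2 / (K * \<tau>\<^sup>2)"
    using \<open>K > 0\<close> \<open>\<sigma> > 0\<close> \<open>\<tau> > 0\<close> by (simp add: field_simps power2_eq_square power4_eq_xxxx)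
  also have "\<dots> = \<delta> / 2"
    using tau_sq \<open>K > 0\<close> \<open>\<tau> > 0\<close> by (simp add: field_simps)
  finally have false_alarm: "false_alarm M (\<lambda>\<omega>. \<lambda>n\<in>I. v n \<omega>) \<phi> \<le> \<delta> / 2" .

  \<comment> \<open>The miss event, as a relation between a path \<open>z\<close> of the system noise and a path \<open>w\<close> of the
      channel noise.\<close>
  define P where "P z w \<longleftrightarrow> (\<Sum>n\<in>I. (one_bit_control s a B z n + w n)\<^sup>2) < \<theta>"
    for z w :: "nat \<Rightarrow> real"
  have miss_path: "prob {\<omega> \<in> space M. P z (\<lambda>n\<in>I. v n \<omega>)} \<le> \<delta> / 2" for z
  proof -
    have energy: "(one_bit_control s a B z n)\<^sup>2 = e" if "n \<in> I" for n
      using one_bit_control_energy[OF \<open>binary_sign s\<close> \<open>a \<noteq> 2\<close>] that \<open>k \<ge> 2\<close> by (simp add: e_def I_def)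
    have "r - \<tau> > 0"
      using gap \<open>\<tau> > 0\<close> \<open>r > 0\<close> by (smt (verit) mult_pos_pos real_sqrt_gt_zero)
    have "{\<omega> \<in> space M. P z (\<lambda>n\<in>I. v n \<omega>)} \<subseteq> {\<omega> \<in> space M.
        K * \<sigma>\<^sup>2 * (r - \<tau>) \<le> \<bar>(\<Sum>n\<in>I. (one_bit_control s a B z n + v n \<omega>)\<^sup>2) - K * (e + \<sigma>\<^sup>2)\<bar>}"
      by (auto simp: P_def \<theta>_def r_eq algebra_simps)
    then have "prob {\<omega> \<in> space M. P z (\<lambda>n\<in>I. v n \<omega>)} \<le> prob {\<omega> \<in> space M.
        K * \<sigma>\<^sup>2 * (r - \<tau>) \<le> \<bar>(\<Sum>n\<in>I. (one_bit_control s a B z n + v n \<omega>)\<^sup>2) - K * (e + \<sigma>\<^sup>2)\<bar>}"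
      using rv by (intro finite_measure_mono) simp_all
    also have "\<dots> \<le> K * (4 * e * \<sigma>\<^sup>2 + 2 * \<sigma> ^ 4) / (K * \<sigma>\<^sup>2 * (r - \<tau>))\<^sup>2"
      using \<open>K > 0\<close> \<open>\<sigma> > 0\<close> \<open>r - \<tau> > 0\<close> by (intro deviation energy) simp_all
    also have "\<dots> \<le> K * (4 * e * \<sigma>\<^sup>2 + 2 * \<sigma> ^ 4) / (K * \<sigma>\<^sup>2 * (\<tau> * sqrt (1 + 2 * r)))\<^sup>2"
      using gap \<open>r - \<tau> > 0\<close> \<open>K > 0\<close> \<open>\<sigma> > 0\<close> \<open>\<tau> > 0\<close> \<open>r > 0\<close>
      by (intro divide_left_mono power_mono mult_left_mono mult_pos_pos zero_less_power) (simp_all add: r_eq)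
    also have "\<dots> = (2 * (K * \<sigma> ^ 4 * (1 + 2 * r))) / (K * \<tau>\<^sup>2 * (K * \<sigma> ^ 4 * (1 + 2 * r)))"
    proof -
      have "K * (4 * e * \<sigma>\<^sup>2 + 2 * \<sigma> ^ 4) = 2 * (K * \<sigma> ^ 4 * (1 + 2 * r))"
        unfolding r_eq by algebra
      moreover have "(sqrt (1 + 2 * r))\<^sup>2 = 1 + 2 * r" using \<open>r > 0\<close> by simp
      then have "(K * \<sigma>\<^sup>2 * (\<tau> * sqrt (1 + 2 * r)))\<^sup>2 = K * \<tau>\<^sup>2 * (K * \<sigma> ^ 4 * (1 + 2 * r))"
        by algebra
      ultimately show ?thesis by (simp only:)
    qed
    also have "\<dots> = 2 / (K * \<tau>\<^sup>2)"
      using \<open>K > 0\<close> \<open>\<sigma> > 0\<close> \<open>r > 0\<close> by (intro mult_divide_mult_cancel_right) simp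
    also have "\<dots> = \<delta> / 2"
      using tau_sq \<open>K > 0\<close> \<open>\<tau> > 0\<close> by (simp add: field_simps)
    finally show ?thesis .
  qed

  have [measurable]: "(\<lambda>z. one_bit_control s a B z n) \<in> borel_measurable (PiM {1..} (\<lambda>_. borel))" for n
    by (rule one_bit_control_measurable[OF \<open>binary_sign s\<close>])
  have "{p \<in> space (PiM {1..} (\<lambda>_. borel) \<Otimes>\<^sub>M PiM I (\<lambda>_. borel)). P (fst p) (snd p)}
      \<in> sets (PiM {1..} (\<lambda>_. borel) \<Otimes>\<^sub>M PiM I (\<lambda>_. borel))"
    unfolding P_def by measurable
  then have mixed: "prob {\<omega> \<in> space M. P (\<lambda>n\<in>{1..}. Z n \<omega>) (\<lambda>n\<in>I. v n \<omega>)} \<le> \<delta> / 2"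
    using prob_le_by_conditioning[OF Z_v_indep[folded I_def], of P "\<delta> / 2"] miss_path \<open>\<delta> > 0\<close>
    by simp
  have control: "one_bit_control s a B (\<lambda>n\<in>{1..}. Z n \<omega>) n = U n \<omega>" for n \<omega>
    unfolding U by (rule one_bit_control_cong) simp
  have miss: "miss_detection M (\<lambda>\<omega>. \<lambda>n\<in>I. U n \<omega> + v n \<omega>) \<phi> \<le> \<delta> / 2"
    using mixed unfolding P_def control by (simp add: miss_detection_def \<phi>_def not_le)

  have "\<phi> \<in> measurable (PiM I (\<lambda>_. borel)) (count_space UNIV)"
    unfolding \<phi>_def by measurable
  with false_alarm miss show ?thesis
    unfolding achieves_detection_def I_def[symmetric] by (intro bexI[of _ \<phi>]) auto
qed

end
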